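(* Let $V^h$, $(\cdot,\cdot)$, $\|\cdot\|$, $A$, $\delta>0$ be as in the context, so that $A=A^*\ge\delta I$ on $V^h$. Let $T>0$, $N\in\mathbb{N}$, $N\ge 1$, $\tau=T/N$, let $\phi,\psi\in V^h$ and put $\chi=A(\phi-\psi)$. Let $(v_n)_{n=0}^{N}\subset V^h$ be the solution of the time-discrete nonlocal problem $$\frac{v_{n+1}-v_n}{\tau}+Av_{n+1}=0,\quad n=0,1,\dots,N-1,\qquad v_N-v_0=\chi,$$ and let $\varphi=A\phi+v_0$ be the corresponding right-hand side. Given an arbitrary $v_0^0\in V^h$, define the iterates $v_n^k\in V^h$ ($0\le n\le N$, $k=0,1,\dots$) as follows: for every $k\ge 0$, starting from $v_0^k$, the values $v_1^k,\dots,v_N^k$ are determined by $$\frac{v_{n+1}^{k}-v_n^{k}}{\tau}+Av_{n+1}^{k}=0,\quad n=0,1,\dots,N-1,$$ and then $$v_0^{k+1}=v_N^{k}-\chi,\qquad \varphi^{k+1}=A\phi+v_0^{k+1}.$$ Then the iterative process converges linearly with speed $$\bar\varrho=(1+\tau\delta)^{-N}<1,$$ and for all $k=0,1,\dots$ the following estimates hold: $$\|v_0^{k+1}-v_0\|\le\bar\varrho\,\|v_0^{k}-v_0\|,\qquad \|\varphi^{k+1}-\varphi\|\le\bar\varrho\,\|v_0^{k}-v_0\|.$$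
   Context: Let $\Omega\subset\mathbb{R}^2$ be a bounded polygon, $(u,v)=\int_\Omega uv\,d\boldsymbol{x}$ and $\|u\|=(u,u)^{1/2}$ the $L_2(\Omega)$ scalar product and norm. Let $k,c$ be functions on $\Omega$ with $0<k_1\le k(\boldsymbol{x})\le k_2$, $c(\boldsymbol{x})\ge 0$, and $\mu$ a function on $\partial\Omega$ with $\mu(\boldsymbol{x})\ge\mu_1>0$, and let $$a(u,v)=\int_\Omega\left(k\,\mathrm{grad}\,u\cdot\mathrm{grad}\,v+c\,uv\right)d\boldsymbol{x}+\int_{\partial\Omega}\mu\,uv\,d\boldsymbol{x}$$ (assumed well defined). $V^h\subset H^1(\Omega)$ is a finite-dimensional (finite element) subspace with the $L_2(\Omega)$ scalar product, and $A:V^h\to V^h$ is defined by $(Ay,v)=a(y,v)$ for all $y,v\in V^h$. Here $\delta>0$ is a constant with $a(u,u)\ge\delta\|u\|^2$, so $A=A^*\ge\delta I$ on $V^h$, where $I$ is the identity operator. The underlying semi-discrete inverse problem is: given $\phi,\psi\in V^h$, find $w(t)\in V^h$ and $\varphi\in V^h$ with $\frac{dw}{dt}+Aw=\varphi$ for $0<t\le T$, $w(0)=\phi$, $w(T)=\psi$. The function $v=\frac{dw}{dt}$ then satisfies $\frac{dv}{dt}+Av=0$, $v(T)-v(0)=\chi=A(\phi-\psi)$, and $\varphi=v(0)+A\phi$. The time-discrete problem in the claim is its fully implicit approximation on the grid $t_n=n\tau$. The inverse problem is assumed to be well-posed. *)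

theory Defs
  imports "HOL-Analysis.Analysis"
begin

definition vertex :: "(real^2) list \<Rightarrow> nat \<Rightarrow> real^2" where
  "vertex ps i = ps ! (i mod length ps)"

definition edge_point :: "(real^2) list \<Rightarrow> nat \<times> real \<Rightarrow> real^2" where
  "edge_point ps = (\<lambda>(i, t). (1 - t) *\<^sub>R vertex ps i + t *\<^sub>R vertex ps (Suc i))"

text \<open>Injectivity on the half-open edges says that the closed polygonal curve does not
  meet itself.\<close>

definition simple_polygon :: "(real^2) list \<Rightarrow> bool" where
  "simple_polygon ps \<longleftrightarrow>
     length ps \<ge> 3 \<and> inj_on (edge_point ps) ({..<length ps} \<times> {0..<1})"

definition polygon_boundary :: "(real^2) list \<Rightarrow> (real^2) set" where
  "polygon_boundary ps = edge_point ps ` ({..<length ps} \<times> {0..<1})"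

definition polygon_region :: "(real^2) list \<Rightarrow> (real^2) set" where
  "polygon_region ps = inside (polygon_boundary ps)"

text \<open>Arc length on the boundary: edge number \<open>i\<close> is parametrised over \<open>[0,1)\<close> with the
  constant speed \<open>dist (vertex ps i) (vertex ps (Suc i))\<close>; see
  \<open>nn_integral_boundary_measure\<close> for the resulting integral.\<close>

definition boundary_measure :: "(real^2) list \<Rightarrow> (real^2) measure" where
  "boundary_measure ps = completion (distr
     (density (count_space {..<length ps} \<Otimes>\<^sub>M restrict_space lborel {0..<1})
        (\<lambda>(i, t). ennreal (dist (vertex ps i) (vertex ps (Suc i)))))
     borel (edge_point ps))"

lemma edge_point_measurable:
  "edge_point ps \<in> borel_measurable (count_space {..<n} \<Otimes>\<^sub>M restrict_space lborel {0..<1})"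
proof (rule measurable_pair_measure_countable1)
  show "countable {..<n}" by simp
  fix i
  have "(\<lambda>t. (1 - t) *\<^sub>R vertex ps i + t *\<^sub>R vertex ps (Suc i)) \<in> borel_measurable lborel"
    by measurable
  then show "(\<lambda>t. edge_point ps (i, t)) \<in> borel_measurable (restrict_space lborel {0..<1})"
    unfolding edge_point_def by (simp add: measurable_restrict_space1)
qed

lemma nn_integral_boundary_measure:
  assumes f: "f \<in> borel_measurable borel"
  shows "(\<integral>\<^sup>+x. f x \<partial>boundary_measure ps) =
    (\<Sum>i<length ps. ennreal (dist (vertex ps i) (vertex ps (Suc i))) *
       (\<integral>\<^sup>+t. f (edge_point ps (i, t)) \<partial>restrict_space lborel {0..<1}))"
proof -
  let ?n = "length ps"
  let ?I = "restrict_space lborel {0..<1::real}"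
  let ?P = "count_space {..<?n} \<Otimes>\<^sub>M ?I"
  let ?w = "\<lambda>i. ennreal (dist (vertex ps i) (vertex ps (Suc i)))"
  let ?W = "\<lambda>(i, t::real). ?w i"
  interpret I: sigma_finite_measure ?I
    by (rule sigma_finite_measure_restrict_space [OF lborel.sigma_finite_measure_axioms]) simp
  have e [measurable]: "edge_point ps \<in> borel_measurable ?P"
    by (rule edge_point_measurable)
  have W [measurable]: "?W \<in> borel_measurable ?P"
    by (rule measurable_pair_measure_countable1) auto
  have e': "edge_point ps \<in> borel_measurable (density ?P ?W)"
    by (subst measurable_cong_sets [OF sets_density refl]) (rule e)
  note f [measurable]
  have g [measurable]: "(\<lambda>z. f (edge_point ps z)) \<in> borel_measurable ?P"
    by measurable
  have "(\<integral>\<^sup>+x. f x \<partial>boundary_measure ps) =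
      (\<integral>\<^sup>+z. f (edge_point ps z) \<partial>density ?P ?W)"
    unfolding boundary_measure_def nn_integral_completion
    by (rule nn_integral_distr) (simp_all only: e' measurable_distr_eq1 f)
  also have "\<dots> = (\<integral>\<^sup>+z. ?W z * f (edge_point ps z) \<partial>?P)"
    by (rule nn_integral_density [OF W g])
  also have "\<dots> = (\<integral>\<^sup>+i. \<integral>\<^sup>+t. ?W (i, t) * f (edge_point ps (i, t)) \<partial>?I \<partial>count_space {..<?n})"
    by (rule I.nn_integral_fst [symmetric]) (rule borel_measurable_times_ennreal [OF W g])
  also have "\<dots> = (\<Sum>i<?n. \<integral>\<^sup>+t. ?W (i, t) * f (edge_point ps (i, t)) \<partial>?I)"
    by (rule nn_integral_count_space_finite) simp
  also have "\<dots> = (\<Sum>i<?n. ?w i * (\<integral>\<^sup>+t. f (edge_point ps (i, t)) \<partial>?I))"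
  proof (rule sum.cong [OF refl])
    fix i assume i: "i \<in> {..<?n}"
    have "(\<lambda>t. f (edge_point ps (i, t))) \<in> borel_measurable ?I"
      using measurable_Pair2 [OF g, of i] i by simp
    then show "(\<integral>\<^sup>+t. ?W (i, t) * f (edge_point ps (i, t)) \<partial>?I) =
        ?w i * (\<integral>\<^sup>+t. f (edge_point ps (i, t)) \<partial>?I)"
      by (simp add: nn_integral_cmult)
  qed
  finally show ?thesis .
qed

text \<open>Elements of \<open>L\<^sub>2\<close> and \<open>H\<^sup>1\<close> are represented by functions; equations between them are
  understood almost everywhere.\<close>

definition square_integrable ::
    "'a measure \<Rightarrow> ('a \<Rightarrow> 'b::{real_inner, second_countable_topology}) \<Rightarrow> bool" where
  "square_integrable M f \<longleftrightarrow>
     f \<in> borel_measurable M \<and> integrable M (\<lambda>x. (norm (f x))\<^sup>2)"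

definition L2_inner ::
    "'a measure \<Rightarrow> ('a \<Rightarrow> 'b::{real_inner, second_countable_topology}) \<Rightarrow> ('a \<Rightarrow> 'b) \<Rightarrow> real" where
  "L2_inner M f g = (\<integral>x. f x \<bullet> g x \<partial>M)"

definition L2_norm ::
    "'a measure \<Rightarrow> ('a \<Rightarrow> 'b::{real_inner, second_countable_topology}) \<Rightarrow> real" where
  "L2_norm M f = sqrt (L2_inner M f f)"

text \<open>\<open>C\<^sup>1\<close> functions with compact support in \<open>S\<close>, together with their gradient. For the weak
  gradient these give the same notion as \<open>C\<^sup>\<infinity>\<close> functions with compact support.\<close>

definition test_function :: "(real^2) set \<Rightarrow> (real^2 \<Rightarrow> real) \<Rightarrow> (real^2 \<Rightarrow> real^2) \<Rightarrow> bool" where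
  "test_function S p dp \<longleftrightarrow>
     (\<forall>x. GDERIV p x :> dp x) \<and> continuous_on UNIV dp \<and>
     (\<exists>K. compact K \<and> K \<subseteq> S \<and> (\<forall>x. x \<notin> K \<longrightarrow> p x = 0))"

definition has_weak_gradient ::
    "(real^2) set \<Rightarrow> (real^2 \<Rightarrow> real) \<Rightarrow> (real^2 \<Rightarrow> real^2) \<Rightarrow> bool" where
  "has_weak_gradient S u g \<longleftrightarrow>
     (\<forall>p dp. test_function S p dp \<longrightarrow>
        (\<integral>x. u x *\<^sub>R dp x \<partial>lebesgue_on S) = - (\<integral>x. p x *\<^sub>R g x \<partial>lebesgue_on S))"

definition H1 :: "(real^2) set \<Rightarrow> (real^2 \<Rightarrow> real) set" where
  "H1 S = {u. square_integrable (lebesgue_on S) u \<and>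
     (\<exists>g. square_integrable (lebesgue_on S) g \<and> has_weak_gradient S u g)}"

text \<open>For \<open>u \<in> H1 S\<close>, \<open>S\<close> open, this is determined up to a null set.\<close>

definition weak_grad :: "(real^2) set \<Rightarrow> (real^2 \<Rightarrow> real) \<Rightarrow> real^2 \<Rightarrow> real^2" where
  "weak_grad S u =
     (SOME g. square_integrable (lebesgue_on S) g \<and> has_weak_gradient S u g)"

definition H1_norm :: "(real^2) set \<Rightarrow> (real^2 \<Rightarrow> real) \<Rightarrow> real" where
  "H1_norm S u =
     sqrt ((L2_norm (lebesgue_on S) u)\<^sup>2 + (L2_norm (lebesgue_on S) (weak_grad S u))\<^sup>2)"

text \<open>The bounded linear operator from \<open>H\<^sup>1\<close> of the polygon to \<open>L\<^sub>2\<close> of its boundary that extends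
  the restriction of functions continuous up to the boundary. By density of these
  functions it is unique up to null sets; it gives the boundary values of functions in \<open>H\<^sup>1\<close>.\<close>

definition trace_operator ::
    "(real^2) list \<Rightarrow> ((real^2 \<Rightarrow> real) \<Rightarrow> real^2 \<Rightarrow> real) \<Rightarrow> bool" where
  "trace_operator ps \<gamma> \<longleftrightarrow>
     (let \<Omega> = polygon_region ps; \<sigma> = boundary_measure ps in
       (\<forall>u\<in>H1 \<Omega>. square_integrable \<sigma> (\<gamma> u)) \<and>
       (\<forall>u\<in>H1 \<Omega>. \<forall>v\<in>H1 \<Omega>. \<forall>a b.
          AE x in \<sigma>. \<gamma> (\<lambda>x. a * u x + b * v x) x = a * \<gamma> u x + b * \<gamma> v x) \<and>
       (\<exists>C. \<forall>u\<in>H1 \<Omega>. L2_norm \<sigma> (\<gamma> u) \<le> C * H1_norm \<Omega> u) \<and>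
       (\<forall>u\<in>H1 \<Omega>. continuous_on (closure \<Omega>) u \<longrightarrow> (AE x in \<sigma>. \<gamma> u x = u x)))"

text \<open>A finite-dimensional subspace of \<open>H\<^sup>1\<close>. The dimension is that of the space of classes modulo
  equality almost everywhere, so \<open>V\<close> may contain one or several representatives of a class.\<close>

definition finite_dim_H1_subspace :: "(real^2) set \<Rightarrow> (real^2 \<Rightarrow> real) set \<Rightarrow> bool" where
  "finite_dim_H1_subspace S V \<longleftrightarrow>
     V \<subseteq> H1 S \<and> (\<lambda>x. 0) \<in> V \<and>
     (\<forall>u\<in>V. \<forall>v\<in>V. (\<lambda>x. u x + v x) \<in> V) \<and>
     (\<forall>r. \<forall>u\<in>V. (\<lambda>x. r * u x) \<in> V) \<and>
     (\<exists>B. finite B \<and> B \<subseteq> V \<and>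
        (\<forall>u\<in>V. \<exists>r. AE x in lebesgue_on S. u x = (\<Sum>b\<in>B. r b * b x)))"

definition domain_integrand ::
    "(real^2) set \<Rightarrow> (real^2 \<Rightarrow> real) \<Rightarrow> (real^2 \<Rightarrow> real) \<Rightarrow>
     (real^2 \<Rightarrow> real) \<Rightarrow> (real^2 \<Rightarrow> real) \<Rightarrow> real^2 \<Rightarrow> real" where
  "domain_integrand S k c u v x =
     k x * (weak_grad S u x \<bullet> weak_grad S v x) + c x * (u x * v x)"

definition boundary_integrand ::
    "((real^2 \<Rightarrow> real) \<Rightarrow> real^2 \<Rightarrow> real) \<Rightarrow> (real^2 \<Rightarrow> real) \<Rightarrow>
     (real^2 \<Rightarrow> real) \<Rightarrow> (real^2 \<Rightarrow> real) \<Rightarrow> real^2 \<Rightarrow> real" where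
  "boundary_integrand \<gamma> \<mu> u v x = \<mu> x * (\<gamma> u x * \<gamma> v x)"

definition energy_form ::
    "(real^2) list \<Rightarrow> ((real^2 \<Rightarrow> real) \<Rightarrow> real^2 \<Rightarrow> real) \<Rightarrow>
     (real^2 \<Rightarrow> real) \<Rightarrow> (real^2 \<Rightarrow> real) \<Rightarrow> (real^2 \<Rightarrow> real) \<Rightarrow>
     (real^2 \<Rightarrow> real) \<Rightarrow> (real^2 \<Rightarrow> real) \<Rightarrow> real" where
  "energy_form ps \<gamma> k c \<mu> u v =
     (\<integral>x. domain_integrand (polygon_region ps) k c u v x \<partial>lebesgue_on (polygon_region ps)) +
     (\<integral>x. boundary_integrand \<gamma> \<mu> u v x \<partial>boundary_measure ps)"

definition energy_form_well_defined_on ::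
    "(real^2 \<Rightarrow> real) set \<Rightarrow> (real^2) list \<Rightarrow> ((real^2 \<Rightarrow> real) \<Rightarrow> real^2 \<Rightarrow> real) \<Rightarrow>
     (real^2 \<Rightarrow> real) \<Rightarrow> (real^2 \<Rightarrow> real) \<Rightarrow> (real^2 \<Rightarrow> real) \<Rightarrow> bool" where
  "energy_form_well_defined_on V ps \<gamma> k c \<mu> \<longleftrightarrow>
     (\<forall>u\<in>V. \<forall>v\<in>V.
        integrable (lebesgue_on (polygon_region ps)) (domain_integrand (polygon_region ps) k c u v) \<and>
        integrable (boundary_measure ps) (boundary_integrand \<gamma> \<mu> u v))"

definition converges_linearly ::
    "'a measure \<Rightarrow> (nat \<Rightarrow> 'a \<Rightarrow> real) \<Rightarrow> ('a \<Rightarrow> real) \<Rightarrow> real \<Rightarrow> bool" where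
  "converges_linearly M f g q \<longleftrightarrow>
     0 < q \<and> q < 1 \<and>
     (\<lambda>j. L2_norm M (\<lambda>x. f j x - g x)) \<longlonglongrightarrow> 0 \<and>
     (\<forall>j. L2_norm M (\<lambda>x. f (Suc j) x - g x) \<le> q * L2_norm M (\<lambda>x. f j x - g x))"

end

theory Submission
  imports Defs
begin

text \<open>The error \<open>w\<^sub>n = v\<^sub>n\<^sup>k - v\<^sub>n\<close> solves the homogeneous implicit scheme. Testing a step with
  \<open>w\<^sub>n\<^sub>+\<^sub>1\<close> and using \<open>A \<ge> \<delta>I\<close> gives \<open>(1 + \<tau>\<delta>) \<parallel>w\<^sub>n\<^sub>+\<^sub>1\<parallel> \<le> \<parallel>w\<^sub>n\<parallel>\<close>, so that \<open>N\<close> steps contract by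
  \<open>(1 + \<tau>\<delta>)\<^sup>-\<^sup>N\<close>; the shift by \<open>\<chi>\<close> cancels in the difference. Linearity of \<open>A\<close>, which would
  need the uniqueness of weak gradients, is avoided: the symmetry of the form already gives
  \<open>(Ay - Az, y - z) = (A(y - z), y - z)\<close>.\<close>

text \<open>Dominated by \<open>(f x)^2 + (g x)^2\<close>. The Bochner integral is additive only on
  integrable functions, so every expansion of an inner product below rests on this.\<close>

lemma square_integrable_mult_integrable:
  fixes f g :: "'a \<Rightarrow> real"
  assumes "square_integrable M f" "square_integrable M g"
  shows "integrable M (\<lambda>x. f x * g x)"
proof (rule Bochner_Integration.integrable_bound)
  show "integrable M (\<lambda>x. (f x)\<^sup>2 + (g x)\<^sup>2)"
    using assms by (simp add: square_integrable_def)
  show "(\<lambda>x. f x * g x) \<in> borel_measurable M"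
    using assms by (auto simp: square_integrable_def)
  have "\<bar>a * b\<bar> \<le> a\<^sup>2 + b\<^sup>2" for a b :: real
  proof -
    have "2 * (\<bar>a\<bar> * \<bar>b\<bar>) \<le> a\<^sup>2 + b\<^sup>2"
      using sum_squares_bound[of "\<bar>a\<bar>" "\<bar>b\<bar>"] by simp
    moreover have "0 \<le> \<bar>a\<bar> * \<bar>b\<bar>" by simp
    ultimately show ?thesis unfolding abs_mult by linarith
  qed
  then show "AE x in M. norm (f x * g x) \<le> norm ((f x)\<^sup>2 + (g x)\<^sup>2)"
    by simp
qed

lemma square_integrable_diff:
  fixes f g :: "'a \<Rightarrow> real"
  assumes "square_integrable M f" "square_integrable M g"
  shows "square_integrable M (\<lambda>x. f x - g x)"
proof -
  have "integrable M (\<lambda>x. (f x)\<^sup>2 + (g x)\<^sup>2 - 2 * (f x * g x))"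
    using square_integrable_mult_integrable[OF assms] assms
    by (simp add: square_integrable_def)
  then show ?thesis
    using assms by (auto simp: square_integrable_def power2_diff mult.assoc)
qed

lemma L2_inner_commute: "L2_inner M f g = L2_inner M g f"
  by (simp add: L2_inner_def inner_commute)

lemma L2_inner_diff_left:
  fixes f g h :: "'a \<Rightarrow> real"
  assumes "square_integrable M f" "square_integrable M g" "square_integrable M h"
  shows "L2_inner M (\<lambda>x. f x - g x) h = L2_inner M f h - L2_inner M g h"
  using square_integrable_mult_integrable[OF assms(1,3)]
    square_integrable_mult_integrable[OF assms(2,3)]
  by (simp add: L2_inner_def left_diff_distrib)

lemma L2_inner_self_nonneg: "0 \<le> L2_inner M f f"
  by (simp add: L2_inner_def)

lemma L2_norm_power2: "(L2_norm M f)\<^sup>2 = L2_inner M f f"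
  by (simp add: L2_norm_def L2_inner_self_nonneg)

lemma L2_norm_nonneg: "0 \<le> L2_norm M f"
  by (simp add: L2_norm_def L2_inner_self_nonneg)

text \<open>The scheme relates functions only almost everywhere; this carries such relations over to
  norms.\<close>

lemma L2_norm_cong_AE:
  assumes "f \<in> borel_measurable M" "g \<in> borel_measurable M" "AE x in M. f x = g x"
  shows "L2_norm M f = L2_norm M g"
proof -
  have "L2_inner M f f = L2_inner M g g"
    unfolding L2_inner_def using assms by (intro integral_cong_AE) auto
  then show ?thesis
    by (simp add: L2_norm_def)
qed

text \<open>The function \<open>r\<close> need not be an operator applied to \<open>w'\<close>; only
  its pairing with \<open>w'\<close> is bounded below. This permits \<open>r = A y - A z\<close>
  with \<open>w' = y - z\<close>.\<close>

lemma implicit_euler_step_L2_contraction: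
  fixes w w' r :: "'a \<Rightarrow> real"
  assumes w: "square_integrable M w" and w': "square_integrable M w'"
    and r: "square_integrable M r"
    and \<tau>: "0 < \<tau>" and \<delta>: "0 \<le> \<delta>"
    and step: "AE x in M. (w' x - w x) / \<tau> + r x = 0"
    and coercive: "\<delta> * (L2_norm M w')\<^sup>2 \<le> L2_inner M r w'"
  shows "(1 + \<tau> * \<delta>) * L2_norm M w' \<le> L2_norm M w"
proof -
  define q where "q = 1 + \<tau> * \<delta>"
  have q: "0 \<le> q" using \<tau> \<delta> by (simp add: q_def)
  note int = square_integrable_mult_integrable
  \<comment> \<open>The step, solved for the old value \<open>w = w' + \<tau> r\<close>, is tested
    with \<open>w'\<close>.\<close>
  have "L2_inner M w w' = (\<integral>x. w' x * w' x + \<tau> * (r x * w' x) \<partial>M)"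
    unfolding L2_inner_def
  proof (rule integral_cong_AE)
    show "AE x in M. w x \<bullet> w' x = w' x * w' x + \<tau> * (r x * w' x)"
      using step
    proof eventually_elim
      case (elim x)
      then have "w x = w' x + \<tau> * r x"
        using \<tau> by (simp add: field_simps)
      then show ?case by (simp add: algebra_simps)
    qed
  qed (use w w' r in \<open>auto simp: square_integrable_def\<close>)
  also have "\<dots> = L2_inner M w' w' + \<tau> * L2_inner M r w'"
    using int[OF w' w'] int[OF r w'] by (simp add: L2_inner_def)
  also have "\<dots> \<ge> q * L2_inner M w' w'"
    using mult_left_mono[OF coercive, of \<tau>] \<tau>
    by (simp add: q_def L2_norm_power2 algebra_simps)
  \<comment> \<open>The factor \<open>q\<close> matches the cross term
    \<open>2 * q * L2_inner M w w'\<close> of the square below.\<close>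
  finally have "q * (q * L2_inner M w' w') \<le> q * L2_inner M w w'"
    using q by (rule mult_left_mono)
  \<comment> \<open>This replaces Cauchy-Schwarz: expanding the square gives ||w||^2 \<ge> 2q (w,w')
    - q^2 ||w'||^2, and (w,w') \<ge> q ||w'||^2 turns the right-hand side into at least q^2
    ||w'||^2.\<close>
  moreover have "0 \<le> (\<integral>x. (w x - q * w' x)\<^sup>2 \<partial>M)"
    by simp
  moreover have "(\<integral>x. (w x - q * w' x)\<^sup>2 \<partial>M) =
      (\<integral>x. w x * w x - 2 * q * (w x * w' x) + q\<^sup>2 * (w' x * w' x) \<partial>M)"
    by (intro Bochner_Integration.integral_cong) (auto simp: power2_eq_square algebra_simps)
  moreover have "\<dots> =
      L2_inner M w w - 2 * q * L2_inner M w w' + q\<^sup>2 * L2_inner M w' w'"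
    using int[OF w w] int[OF w w'] int[OF w' w'] by (simp add: L2_inner_def)
  ultimately have "q\<^sup>2 * L2_inner M w' w' \<le> L2_inner M w w"
    unfolding power2_eq_square mult.assoc by linarith
  then have "(q * L2_norm M w')\<^sup>2 \<le> (L2_norm M w)\<^sup>2"
    by (simp add: power_mult_distrib L2_norm_power2)
  then show ?thesis
    unfolding q_def[symmetric] by (rule power2_le_imp_le) (rule L2_norm_nonneg)
qed

lemma energy_form_commute: "energy_form ps \<gamma> k c \<mu> u v = energy_form ps \<gamma> k c \<mu> v u"
  by (simp add: energy_form_def domain_integrand_def boundary_integrand_def
      inner_commute mult.commute)

lemma finite_dim_H1_subspace_diff:
  assumes "finite_dim_H1_subspace S V" "u \<in> V" "v \<in> V"
  shows "(\<lambda>x. u x - v x) \<in> V"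
proof -
  have add: "(\<lambda>x. f x + g x) \<in> V" if "f \<in> V" "g \<in> V" for f g
    using assms(1) that by (simp add: finite_dim_H1_subspace_def)
  have scale: "(\<lambda>x. r * f x) \<in> V" if "f \<in> V" for r f
    using assms(1) that by (simp add: finite_dim_H1_subspace_def)
  show ?thesis
    using add[OF assms(2) scale[OF assms(3), of "- 1"]] by simp
qed

lemma finite_dim_H1_subspace_square_integrable:
  assumes "finite_dim_H1_subspace S V" "u \<in> V"
  shows "square_integrable (lebesgue_on S) u"
  using assms by (auto simp: finite_dim_H1_subspace_def H1_def)

text \<open>Iterating the one-step bound dominates the errors by a geometric sequence, so the
  contraction alone yields the limit.\<close>

lemma converges_linearlyI:
  assumes q: "0 < q" "q < 1"
    and contr: "\<And>j. L2_norm M (\<lambda>x. f (Suc j) x - g x) \<le> q * L2_norm M (\<lambda>x. f j x - g x)"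
  shows "converges_linearly M f g q"
proof -
  let ?e = "\<lambda>j. L2_norm M (\<lambda>x. f j x - g x)"
  have bound: "?e j \<le> q ^ j * ?e 0" for j
  proof (induction j)
    case (Suc j)
    have "?e (Suc j) \<le> q * ?e j" by (rule contr)
    also have "\<dots> \<le> q * (q ^ j * ?e 0)"
      using Suc q by (intro mult_left_mono) auto
    finally show ?case by (simp add: mult.assoc)
  qed simp
  have lim: "(\<lambda>j. q ^ j * ?e 0) \<longlonglongrightarrow> 0"
    using q by (intro tendsto_mult_left_zero LIMSEQ_power_zero) auto
  have "?e \<longlonglongrightarrow> 0"
    by (rule tendsto_sandwich[OF _ _ tendsto_const lim])
      (auto intro: always_eventually bound L2_norm_nonneg)
  then show ?thesis
    using q contr by (simp add: converges_linearly_def)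
qed

theorem theorem1:
  fixes ps :: "(real^2) list"
    and \<Omega> :: "(real^2) set"
    and L :: "(real^2) measure"
    and \<gamma> :: "(real^2 \<Rightarrow> real) \<Rightarrow> real^2 \<Rightarrow> real"
    and k c \<mu> :: "real^2 \<Rightarrow> real"
    and k1 k2 \<mu>1 \<delta> T \<tau> \<rho> :: real
    and V :: "(real^2 \<Rightarrow> real) set"
    and A :: "(real^2 \<Rightarrow> real) \<Rightarrow> real^2 \<Rightarrow> real"
    and N :: nat
    and \<phi> \<psi> chi \<phi>rhs :: "real^2 \<Rightarrow> real"
    and v :: "nat \<Rightarrow> real^2 \<Rightarrow> real"
    and vit :: "nat \<Rightarrow> nat \<Rightarrow> real^2 \<Rightarrow> real"
    and \<phi>it :: "nat \<Rightarrow> real^2 \<Rightarrow> real"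
  assumes polygon: "simple_polygon ps"
    and Omega: "\<Omega> = polygon_region ps"
    and L: "L = lebesgue_on \<Omega>"
    and trace: "trace_operator ps \<gamma>"
    and k_bounds: "0 < k1" "\<forall>x\<in>\<Omega>. k1 \<le> k x \<and> k x \<le> k2"
    and c_nonneg: "\<forall>x\<in>\<Omega>. 0 \<le> c x"
    and mu_bound: "0 < \<mu>1" "\<forall>x\<in>polygon_boundary ps. \<mu>1 \<le> \<mu> x"
    and V: "finite_dim_H1_subspace \<Omega> V"
    and form: "energy_form_well_defined_on V ps \<gamma> k c \<mu>"
    and A_into: "\<forall>y\<in>V. A y \<in> V"
    and A_form: "\<forall>y\<in>V. \<forall>z\<in>V. L2_inner L (A y) z = energy_form ps \<gamma> k c \<mu> y z"
    and delta: "0 < \<delta>" "\<forall>u\<in>V. energy_form ps \<gamma> k c \<mu> u u \<ge> \<delta> * (L2_norm L u)\<^sup>2"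
    and T: "0 < T"
    and N: "1 \<le> N"
    and tau: "\<tau> = T / real N"
    and data: "\<phi> \<in> V" "\<psi> \<in> V"
    and chi_def: "chi = A (\<lambda>x. \<phi> x - \<psi> x)"
    and v_in: "\<forall>n\<le>N. v n \<in> V"
    and v_step: "\<forall>n<N. AE x in L. (v (Suc n) x - v n x) / \<tau> + A (v (Suc n)) x = 0"
    and v_nonlocal: "AE x in L. v N x - v 0 x = chi x"
    and rhs: "\<phi>rhs = (\<lambda>x. A \<phi> x + v 0 x)"
    and vit_in: "\<forall>j. \<forall>n\<le>N. vit j n \<in> V"
    and vit_step: "\<forall>j. \<forall>n<N. AE x in L.
        (vit j (Suc n) x - vit j n x) / \<tau> + A (vit j (Suc n)) x = 0"
    and vit_next: "\<forall>j. AE x in L. vit (Suc j) 0 x = vit j N x - chi x"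
    and rhs_next: "\<forall>j. \<phi>it (Suc j) = (\<lambda>x. A \<phi> x + vit (Suc j) 0 x)"
    and rho: "\<rho> = (1 + \<tau> * \<delta>) powi (- int N)"
  shows "\<rho> < 1 \<and>
    converges_linearly L (\<lambda>j. vit j 0) (v 0) \<rho> \<and>
    converges_linearly L (\<lambda>j. \<phi>it (Suc j)) \<phi>rhs \<rho> \<and>
    (\<forall>j. L2_norm L (\<lambda>x. vit (Suc j) 0 x - v 0 x) \<le> \<rho> * L2_norm L (\<lambda>x. vit j 0 x - v 0 x)) \<and>
    (\<forall>j. L2_norm L (\<lambda>x. \<phi>it (Suc j) x - \<phi>rhs x) \<le> \<rho> * L2_norm L (\<lambda>x. vit j 0 x - v 0 x))"
proof -
  have mono_A: "\<delta> * (L2_norm L (\<lambda>x. y x - z x))\<^sup>2 \<le>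
      L2_inner L (\<lambda>x. A y x - A z x) (\<lambda>x. y x - z x)"
    if y: "y \<in> V" and z: "z \<in> V" for y z
  proof -
    let ?w = "\<lambda>x. y x - z x"
    note sq = finite_dim_H1_subspace_square_integrable[OF V, folded L]
    have w: "?w \<in> V"
      using finite_dim_H1_subspace_diff[OF V y z] .
    \<comment> \<open>Once \<open>A\<close> acts on the fixed difference \<open>?w\<close>, the
      remaining splitting is pointwise linearity in \<open>y\<close> and \<open>z\<close>.\<close>
    have sym: "L2_inner L (A f) ?w = L2_inner L f (A ?w)" if "f \<in> V" for f
      using A_form that w energy_form_commute L2_inner_commute by metis
    have "L2_inner L (\<lambda>x. A y x - A z x) ?w = L2_inner L y (A ?w) - L2_inner L z (A ?w)"
      using L2_inner_diff_left[OF sq sq sq, of "A y" "A z" ?w] A_into y z w sym by simp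
    also have "\<dots> = L2_inner L ?w (A ?w)"
      using L2_inner_diff_left[OF sq sq sq, of y z "A ?w"] A_into y z w by simp
    also have "\<dots> = energy_form ps \<gamma> k c \<mu> ?w ?w"
      using A_form w by (simp add: L2_inner_commute)
    finally show ?thesis
      using delta(2) w by simp
  qed
  note sq = finite_dim_H1_subspace_square_integrable[OF V, folded L]
  have \<tau>: "0 < \<tau>"
    using T N tau by simp
  define q where "q = 1 + \<tau> * \<delta>"
  have q: "1 < q"
    using \<tau> delta(1) by (simp add: q_def)
  have \<rho>_eq: "\<rho> = 1 / q ^ N"
    by (simp add: rho q_def power_int_minus divide_simps)
  \<comment> \<open>Strictness uses \<open>1 \<le> N\<close>: for \<open>N = 0\<close> the factor
    would be 1.\<close>
  have \<rho>: "0 < \<rho>" "\<rho> < 1"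
    using q N one_less_power[OF q, of N] by (auto simp: \<rho>_eq)
  \<comment> \<open>The bound is kept free of division for the induction; the bound
    \<open>n \<le> N\<close> is the range in which both schemes are given.\<close>
  have steps: "q ^ n * L2_norm L (\<lambda>x. vit j n x - v n x) \<le> L2_norm L (\<lambda>x. vit j 0 x - v 0 x)"
    if "n \<le> N" for j n
    using that
  proof (induction n)
    case (Suc n)
    let ?w = "\<lambda>n x. vit j n x - v n x"
    have in_V: "vit j n \<in> V" "vit j (Suc n) \<in> V" "v n \<in> V" "v (Suc n) \<in> V"
      using Suc.prems vit_in v_in by auto
    have "q * L2_norm L (?w (Suc n)) \<le> L2_norm L (?w n)"
      unfolding q_def
    proof (rule implicit_euler_step_L2_contraction)
      let ?r = "\<lambda>x. A (vit j (Suc n)) x - A (v (Suc n)) x"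
      show "square_integrable L (?w n)" "square_integrable L (?w (Suc n))" "square_integrable L ?r"
        using in_V A_into by (auto intro: square_integrable_diff sq)
      have "AE x in L. (vit j (Suc n) x - vit j n x) / \<tau> + A (vit j (Suc n)) x = 0"
        "AE x in L. (v (Suc n) x - v n x) / \<tau> + A (v (Suc n)) x = 0"
        using vit_step v_step Suc.prems by auto
      \<comment> \<open>Subtracting the two schemes leaves a homogeneous step for the error, with
        the difference of the two \<open>A\<close> terms as \<open>?r\<close>.\<close>
      then show "AE x in L. (?w (Suc n) x - ?w n x) / \<tau> + ?r x = 0"
        by eventually_elim (simp add: diff_divide_distrib)
      show "\<delta> * (L2_norm L (?w (Suc n)))\<^sup>2 \<le> L2_inner L ?r (?w (Suc n))"
        using mono_A in_V by blast
    qed (use \<tau> delta in auto)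
    then have "q ^ n * (q * L2_norm L (?w (Suc n))) \<le> q ^ n * L2_norm L (?w n)"
      using q by (intro mult_left_mono) auto
    with Suc show ?case
      by (simp add: mult_ac)
  qed simp
  have contr: "L2_norm L (\<lambda>x. vit (Suc j) 0 x - v 0 x) \<le> \<rho> * L2_norm L (\<lambda>x. vit j 0 x - v 0 x)"
    for j
  proof -
    \<comment> \<open>The update and the nonlocal condition shift by the same \<open>chi\<close>, so
      the new initial error is the old final error.\<close>
    have "L2_norm L (\<lambda>x. vit (Suc j) 0 x - v 0 x) = L2_norm L (\<lambda>x. vit j N x - v N x)"
    proof (rule L2_norm_cong_AE)
      have "AE x in L. vit (Suc j) 0 x = vit j N x - chi x"
        using vit_next by blast
      with v_nonlocal show "AE x in L. vit (Suc j) 0 x - v 0 x = vit j N x - v N x"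
        by eventually_elim simp
      show "(\<lambda>x. vit (Suc j) 0 x - v 0 x) \<in> borel_measurable L"
        "(\<lambda>x. vit j N x - v N x) \<in> borel_measurable L"
        using square_integrable_diff[OF sq sq] vit_in v_in
        by (auto simp: square_integrable_def)
    qed
    then show ?thesis
      using steps[of N j] q by (simp add: \<rho>_eq field_simps)
  qed
  \<comment> \<open>The common term \<open>A \<phi>\<close> cancels, so both estimates are the same
    inequality.\<close>
  have rhs_diff: "(\<lambda>x. \<phi>it (Suc j) x - \<phi>rhs x) = (\<lambda>x. vit (Suc j) 0 x - v 0 x)" for j
    by (simp add: rhs rhs_next)
  have "converges_linearly L (\<lambda>j. vit j 0) (v 0) \<rho>"
    using \<rho> contr by (rule converges_linearlyI)
  \<comment> \<open>The sequence starts at index 1, since the iteration defines no right-hand side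
    at index 0.\<close>
  moreover have "converges_linearly L (\<lambda>j. \<phi>it (Suc j)) \<phi>rhs \<rho>"
    using \<rho> by (rule converges_linearlyI) (simp only: rhs_diff contr)
  ultimately show ?thesis
    using \<rho>(2) contr rhs_diff by simp
qed

end
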